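(* Let $S$ and $T$ be disjoint non-empty finite sets, $V:=S\cup T$. Let $H_0=(S,T;F_0)$ be a simple bipartite graph and let $G_0=(S,T;E_0)$ be its bipartite complement. Let $M_S=(S,r_S)$ be a matroid on $S$ with rank function $r_S$, let $p_T$ be an integer-valued positively intersecting supermodular set-function on $T$, and let $m_V=(m_S,m_T)$ be a degree-specification on $V$ (non-negative integers) with $\widetilde m_S(S)=\widetilde m_T(T)=\gamma$. Then there exists a bipartite graph $G=(S,T;E)$ fitting $m_V$ such that $G^+=G+H_0$ (the bigraph on $(S,T)$ with edge set $E\cup F_0$) is simple and $M_S$-covers $p_T$ if and only if $$\widetilde m_S(X)+\widetilde m_T(Y)-d_{G_0}(X,Y)+\sum_{i=1}^{q}\bigl[p_T(T_i)-r_S(X\cup\Gamma_{H_0}(T_i))\bigr]\le \gamma$$ holds whenever $X\subseteq S$, $Y\subseteq T$, and $\{T_1,\dots,T_q\}$ is a subpartition of $T-Y$.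
   Context: A bipartite graph (bigraph) $G=(S,T;E)$ has all edges between $S$ and $T$; parallel edges are a priori allowed, and $G$ is simple if it has no parallel edges. The bipartite complement of a simple bigraph $H_0=(S,T;F_0)$ is the bigraph $G_0=(S,T;E_0)$ where $E_0$ consists of all pairs $st$ ($s\in S,t\in T$) not in $F_0$. For $X\subseteq S$, $Y\subseteq T$, $d_{G_0}(X,Y)$ is the number of edges of $G_0$ with one end in $X$ and the other in $Y$. For a bigraph $H$ and $Y\subseteq T$, $\Gamma_H(Y)$ denotes the set of nodes of $S$ adjacent in $H$ to some node of $Y$. For $m:V\to\mathbb{R}$, $\widetilde m(Z)=\sum_{v\in Z}m(v)$. A bigraph $G$ fits $m_V=(m_S,m_T)$ if $d_G(v)=m_V(v)$ for every $v\in S\cup T$. A subpartition of a set is a family of pairwise disjoint non-empty subsets of it (the empty family, $q=0$, is allowed). A set-function $p$ on $T$ is positively intersecting supermodular if $p(A)+p(B)\le p(A\cap B)+p(A\cup B)$ holds for all subsets $A,B\subseteq T$ with $A\cap B\neq\emptyset$, $A,B$ non-comparable, $p(A)>0$ and $p(B)>0$. A bigraph $G$ $M_S$-covers $p_T$ if $r_S(\Gamma_G(Y))\ge p_T(Y)$ for every $Y\subseteq T$.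
   Formalization: The formal theorem additionally assumes p_T(∅) ≤ 0 (implied by the usual convention p_T(∅) = 0); without it the equivalence fails, since covering Y = ∅ requires r_S(∅) = 0 ≥ p_T(∅) while subpartition members are non-empty. *)

theory Defs
  imports Main "HOL-Library.Multiset" "HOL-Library.Disjoint_Sets"
begin

text \<open>
  The edges of a bigraph on \<open>(S, T)\<close> form a multiset of pairs \<open>(s, t)\<close> with \<open>s \<in> S\<close> and
  \<open>t \<in> T\<close>; the multiplicity of a pair is the number of parallel edges joining its ends.
  The sum \<open>G + H\<close> of two bigraphs on the same classes is the multiset sum, so an edge
  of \<open>G\<close> and an edge of \<open>H\<close> with the same ends are parallel in \<open>G + H\<close>.
\<close>

type_synonym 'v bigraph = "('v \<times> 'v) multiset"

definition is_bigraph :: "'v set \<Rightarrow> 'v set \<Rightarrow> 'v bigraph \<Rightarrow> bool" where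
  "is_bigraph S T G \<longleftrightarrow> set_mset G \<subseteq> S \<times> T"

definition simple :: "'v bigraph \<Rightarrow> bool" where
  "simple G \<longleftrightarrow> (\<forall>e. count G e \<le> 1)"

definition bip_complement :: "'v set \<Rightarrow> 'v set \<Rightarrow> 'v bigraph \<Rightarrow> 'v bigraph" where
  "bip_complement S T H = mset_set {e \<in> S \<times> T. e \<notin># H}"

definition edges_between :: "'v bigraph \<Rightarrow> 'v set \<Rightarrow> 'v set \<Rightarrow> nat" where
  "edges_between G X Y = size {#e \<in># G. fst e \<in> X \<and> snd e \<in> Y#}"

definition degree :: "'v bigraph \<Rightarrow> 'v \<Rightarrow> nat" where
  "degree G v = size {#e \<in># G. fst e = v \<or> snd e = v#}"

definition fits :: "'v set \<Rightarrow> 'v set \<Rightarrow> 'v bigraph \<Rightarrow> ('v \<Rightarrow> nat) \<Rightarrow> bool" where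
  "fits S T G m \<longleftrightarrow> (\<forall>v \<in> S \<union> T. degree G v = m v)"

definition neighbours :: "'v bigraph \<Rightarrow> 'v set \<Rightarrow> 'v set" where
  "neighbours G Y = {s. \<exists>t \<in> Y. (s, t) \<in># G}"

definition subpartition :: "'v set \<Rightarrow> 'v set set \<Rightarrow> bool" where
  "subpartition A P \<longleftrightarrow> \<Union>P \<subseteq> A \<and> disjoint P \<and> {} \<notin> P"

text \<open>
  A matroid \<open>(S, r)\<close> on a finite ground set, given by its rank function. Only the values of
  \<open>r\<close> on subsets of \<open>S\<close> are relevant.
\<close>

definition matroid :: "'v set \<Rightarrow> ('v set \<Rightarrow> nat) \<Rightarrow> bool" where
  "matroid S r \<longleftrightarrow> finite S \<and>
     (\<forall>X \<subseteq> S. r X \<le> card X) \<and>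
     (\<forall>Y \<subseteq> S. \<forall>X \<subseteq> Y. r X \<le> r Y) \<and>
     (\<forall>X \<subseteq> S. \<forall>Y \<subseteq> S. r (X \<inter> Y) + r (X \<union> Y) \<le> r X + r Y)"

definition positively_intersecting_supermodular :: "'v set \<Rightarrow> ('v set \<Rightarrow> int) \<Rightarrow> bool" where
  "positively_intersecting_supermodular T p \<longleftrightarrow>
     (\<forall>A \<subseteq> T. \<forall>B \<subseteq> T.
        A \<inter> B \<noteq> {} \<and> \<not> A \<subseteq> B \<and> \<not> B \<subseteq> A \<and> p A > 0 \<and> p B > 0 \<longrightarrow>
        p A + p B \<le> p (A \<inter> B) + p (A \<union> B))"

definition matroid_covers ::
    "'v set \<Rightarrow> ('v set \<Rightarrow> nat) \<Rightarrow> 'v bigraph \<Rightarrow> ('v set \<Rightarrow> int) \<Rightarrow> bool" where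
  "matroid_covers T r G p \<longleftrightarrow> (\<forall>Y \<subseteq> T. int (r (neighbours G Y)) \<ge> p Y)"

end

theory Submission
  imports Defs
begin

text \<open>
  A pair \<open>X \<subseteq> S\<close>, \<open>A \<subseteq> T\<close> is encoded as the single set \<open>Z = X \<union> A\<close>, which an edge \<open>(s, t)\<close> enters
  if \<open>t \<in> A\<close> and \<open>s \<notin> X\<close>. Each requirement on \<open>G\<close> says that enough edges enter each set:
  the cover asks for \<open>p A - r (X \<union> \<Gamma>(A))\<close> edges, and the degree at \<open>t\<close> together with simplicity
  asks for \<open>m t - d (X, t)\<close> edges entering \<open>X \<union> {t}\<close>. The maximum \<open>q\<close> of these demands is
  supermodular on pairs of sets that meet inside \<open>T\<close>, and the hypothesis says that \<open>q\<close> sums to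
  at most \<open>m (S - \<Inter>L)\<close> over any family \<open>L\<close> of sets that are disjoint inside \<open>T\<close>.

  Uncrossing turns this bound into a weak-duality bound for arbitrary multisets of sets. The edges
  of \<open>G\<close> are then chosen greedily. Take any \<open>t\<close> with \<open>m t > 0\<close>. If no \<open>s\<close> with \<open>m s > 0\<close> could be
  joined to \<open>t\<close>, then each such \<open>s\<close> would have a tight family \<open>L s\<close> no member of which is entered
  by \<open>(s, t)\<close>. The sum of all \<open>L s\<close> has room for one more copy of \<open>{t}\<close>, and the duality bound
  yields \<open>m t \<le> 0\<close>.
\<close>

section \<open>Set pairs, edges entering them, and packings\<close>

definition entering :: "'v \<times> 'v \<Rightarrow> 'v set \<Rightarrow> bool" where
  "entering e Z \<longleftrightarrow> snd e \<in> Z \<and> fst e \<notin> Z"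

definition positively_supermodular_on :: "'v set \<Rightarrow> 'v set \<Rightarrow> ('v set \<Rightarrow> int) \<Rightarrow> bool" where
  "positively_supermodular_on S T q \<longleftrightarrow>
     (\<forall>Z W. Z \<subseteq> S \<union> T \<and> W \<subseteq> S \<union> T \<and> Z \<inter> W \<inter> T \<noteq> {} \<and> q Z > 0 \<and> q W > 0 \<longrightarrow>
        q Z + q W \<le> q (Z \<inter> W) + q (Z \<union> W))"

text \<open>Members may overlap inside \<open>S\<close> but not inside \<open>T\<close>. An edge
  from \<open>S\<close> to \<open>T\<close> therefore enters at most one member, and only if its end
  in \<open>S\<close> lies outside \<open>\<Inter>L\<close>; this makes
  \<open>sum m (S - \<Inter>L)\<close> the natural limit on the total demand.\<close>

definition packing :: "'v set \<Rightarrow> 'v set \<Rightarrow> 'v set set \<Rightarrow> bool" where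
  "packing S T L \<longleftrightarrow> L \<subseteq> Pow (S \<union> T) \<and> (\<forall>Z\<in>L. Z \<inter> T \<noteq> {}) \<and>
     (\<forall>Z\<in>L. \<forall>W\<in>L. Z \<noteq> W \<longrightarrow> Z \<inter> W \<inter> T = {})"

text \<open>\<open>\<Inter>{} = UNIV\<close>, so the empty family only requires \<open>0 \<le> 0\<close>.\<close>

definition packing_bound :: "'v set \<Rightarrow> 'v set \<Rightarrow> ('v set \<Rightarrow> int) \<Rightarrow> ('v \<Rightarrow> nat) \<Rightarrow> bool" where
  "packing_bound S T q m \<longleftrightarrow>
     (\<forall>L. packing S T L \<longrightarrow> sum q L \<le> int (sum m (S - \<Inter>L)))"

section \<open>Uncrossing and the weak-duality bound\<close>

text \<open>In terms of \<open>c\<close>, \<open>x\<close>, \<open>y\<close> below, the two sides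
  differ by \<open>2 * x * y\<close>. The strict growth makes uncrossing terminate.\<close>

lemma sum_squares_uncross_less:
  assumes "finite Z" "finite W" "\<not> Z \<subseteq> W" "\<not> W \<subseteq> Z"
  shows "(card Z)\<^sup>2 + (card W)\<^sup>2 < (card (Z \<inter> W))\<^sup>2 + (card (Z \<union> W))\<^sup>2"
proof -
  define c x y where "c = card (Z \<inter> W)" and "x = card (Z - W)" and "y = card (W - Z)"
  have "card Z = c + x"
    unfolding c_def x_def using card_Int_Diff[OF assms(1)] .
  moreover have "card W = c + y"
    unfolding c_def y_def using card_Int_Diff[OF assms(2), of Z] by (simp add: Int_commute)
  moreover have "card Z + card W = card (Z \<union> W) + c"
    unfolding c_def using card_Un_Int[OF assms(1,2)] .
  moreover have "x > 0" "y > 0"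
    using assms by (auto simp: x_def y_def card_gt_0_iff)
  ultimately have "card (Z \<union> W) = c + x + y" "card Z = c + x" "card W = c + y" "x * y > 0"
    by auto
  then show ?thesis
    unfolding c_def[symmetric] by (simp add: power2_eq_square algebra_simps)
qed

text \<open>For a bigraph that meets all demands and has degrees \<open>m\<close> on
  \<open>S\<close>, counting pairs of an edge and a member it enters would give this inequality. The
  point is that the bound for packings alone already forces it: uncrossing leads to a laminar
  family, from which packings are peeled off.\<close>

lemma family_bound:
  fixes F :: "'v set multiset" and a m :: "'v \<Rightarrow> nat"
  assumes fin: "finite S" "finite T"
    and super: "positively_supermodular_on S T q"
    and pack: "packing_bound S T q m"
  shows "(\<forall>Z\<in>#F. Z \<subseteq> S \<union> T \<and> Z \<inter> T \<noteq> {}) \<Longrightarrow>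
    (\<forall>u\<in>S. \<forall>t\<in>T. size {#Z \<in># F. entering (u, t) Z#} \<le> a u) \<Longrightarrow>
    (\<Sum>Z\<in>#F. q Z) \<le> int (\<Sum>u\<in>S. m u * a u)"
proof (induction "\<Sum>Z\<in>#F. Suc ((card (S \<union> T))\<^sup>2) - (card Z)\<^sup>2" arbitrary: F a rule: less_induct)
  case less
  \<comment> \<open>Every member has positive weight, so discarding members lowers the measure;
    uncrossing lowers it because the sum of squared sizes grows.\<close>
  let ?w = "\<lambda>Z. Suc ((card (S \<union> T))\<^sup>2) - (card Z)\<^sup>2"
  have w_pos: "?w Z > 0" if "Z \<subseteq> S \<union> T" for Z
  proof -
    have "card Z \<le> card (S \<union> T)"
      using that fin by (intro card_mono) auto
    then have "(card Z)\<^sup>2 \<le> (card (S \<union> T))\<^sup>2"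
      by (rule power_mono) simp
    then show ?thesis by linarith
  qed
  have w: "?w Z + (card Z)\<^sup>2 = Suc ((card (S \<union> T))\<^sup>2)" if "Z \<subseteq> S \<union> T" for Z
    using w_pos[OF that] by linarith
  have FV: "Z \<subseteq> S \<union> T" and FT: "Z \<inter> T \<noteq> {}" if "Z \<in># F" for Z
    using less.prems(1) that by auto
  \<comment> \<open>Supermodularity is available only for positive demands, so members with
    nonpositive demand are discarded first. Incomparable members may stay as long as they share no
    node of \<open>T\<close>.\<close>
  consider (nonpos) Z where "Z \<in># F" "q Z \<le> 0"
    | (cross) Z W where "Z \<in># F" "W \<in># F" "\<not> Z \<subseteq> W" "\<not> W \<subseteq> Z" "Z \<inter> W \<inter> T \<noteq> {}" "q Z > 0" "q W > 0"
    | (laminar) "\<And>Z W. Z \<in># F \<Longrightarrow> W \<in># F \<Longrightarrow> Z \<inter> W \<inter> T \<noteq> {} \<Longrightarrow> Z \<subseteq> W \<or> W \<subseteq> Z"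
    by (metis not_le)
  then show ?case
  proof cases
    case nonpos
    then obtain F' where F: "F = add_mset Z F'"
      by (meson multi_member_split)
    have "(\<Sum>Z\<in>#F'. q Z) \<le> int (\<Sum>u\<in>S. m u * a u)"
    proof (rule less.hyps)
      show "(\<Sum>Z\<in>#F'. ?w Z) < (\<Sum>Z\<in>#F. ?w Z)"
        using w_pos[OF FV[OF nonpos(1)]] by (simp add: F)
      show "\<forall>Z\<in>#F'. Z \<subseteq> S \<union> T \<and> Z \<inter> T \<noteq> {}"
        using less.prems(1) by (simp add: F)
      show "\<forall>u\<in>S. \<forall>t\<in>T. size {#Z \<in># F'. entering (u, t) Z#} \<le> a u"
        using less.prems(2) unfolding F by (fastforce split: if_splits)
    qed
    then show ?thesis using nonpos(2) by (simp add: F)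
  next
    case cross
    then obtain F1 where F1: "F = add_mset Z F1"
      by (meson multi_member_split)
    with cross have "W \<in># F1" by auto
    then obtain F' where F: "F = add_mset Z (add_mset W F')"
      using F1 by (metis multi_member_split)
    define F'' where "F'' = add_mset (Z \<inter> W) (add_mset (Z \<union> W) F')"
    note ZV = FV[OF cross(1)] and WV = FV[OF cross(2)]
    have "(\<Sum>Z\<in>#F''. q Z) \<le> int (\<Sum>u\<in>S. m u * a u)"
    proof (rule less.hyps)
      have "finite Z" "finite W"
        using ZV WV fin by (auto intro: finite_subset)
      then have "(card Z)\<^sup>2 + (card W)\<^sup>2 < (card (Z \<inter> W))\<^sup>2 + (card (Z \<union> W))\<^sup>2"
        using cross by (intro sum_squares_uncross_less)
      moreover have w_inter: "?w (Z \<inter> W) + (card (Z \<inter> W))\<^sup>2 = Suc ((card (S \<union> T))\<^sup>2)"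
        using ZV by (intro w) blast
      moreover have w_union: "?w (Z \<union> W) + (card (Z \<union> W))\<^sup>2 = Suc ((card (S \<union> T))\<^sup>2)"
        using ZV WV by (intro w) blast
      ultimately have "?w (Z \<inter> W) + ?w (Z \<union> W) < ?w Z + ?w W"
        using w[OF ZV] w[OF WV] w_inter w_union by linarith
      then show "(\<Sum>Z\<in>#F''. ?w Z) < (\<Sum>Z\<in>#F. ?w Z)"
        by (simp add: F F''_def)
      show "\<forall>Z\<in>#F''. Z \<subseteq> S \<union> T \<and> Z \<inter> T \<noteq> {}"
        using less.prems(1) cross(5) by (auto simp: F F''_def)
      show "\<forall>u\<in>S. \<forall>t\<in>T. size {#Z \<in># F''. entering (u, t) Z#} \<le> a u"
      proof (intro ballI)
        fix u t assume "u \<in> S" "t \<in> T"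
        then have "size {#Z \<in># F. entering (u, t) Z#} \<le> a u"
          using less.prems(2) by blast
        moreover have "size {#Z \<in># F''. entering (u, t) Z#} \<le> size {#Z \<in># F. entering (u, t) Z#}"
        proof -
          have add: "size {#Z \<in># add_mset A M. entering (u, t) Z#} =
              of_bool (entering (u, t) A) + size {#Z \<in># M. entering (u, t) Z#}" for A M
            by simp
          \<comment> \<open>Being entered by a fixed edge is submodular, so \<open>a\<close> stays a
            valid bound after uncrossing.\<close>
          have "of_bool (entering (u, t) (Z \<inter> W)) + of_bool (entering (u, t) (Z \<union> W))
              \<le> of_bool (entering (u, t) Z) + (of_bool (entering (u, t) W) :: nat)"
            by (auto simp: entering_def)
          then show ?thesis unfolding F F''_def add by linarith
        qed
        ultimately show "size {#Z \<in># F''. entering (u, t) Z#} \<le> a u"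
          by linarith
      qed
    qed
    moreover have "q Z + q W \<le> q (Z \<inter> W) + q (Z \<union> W)"
      using super cross ZV WV unfolding positively_supermodular_on_def by blast
    ultimately show ?thesis by (simp add: F F''_def)
  next
    case laminar
    show ?thesis
    proof (cases "F = {#}")
      case True
      then show ?thesis by (simp add: sum_nonneg)
    next
      case False
      \<comment> \<open>Peel off one copy of each minimal member; the bound \<open>a\<close> then drops by one on \<open>S - \<Inter>L\<close>.\<close>
      define L where "L = {Z \<in> set_mset F. \<forall>W \<in># F. W \<subseteq> Z \<longrightarrow> W = Z}"
      have "finite L" by (simp add: L_def)
      have LF: "Z \<in># F" if "Z \<in> L" for Z using that by (simp add: L_def)
      have below: "\<exists>W\<in>L. W \<subseteq> Z" if "Z \<in># F" for Z
      proof -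
        obtain W where "W \<in># F" "W \<subseteq> Z" "\<forall>B\<in>#F. B \<subseteq> W \<longrightarrow> W = B"
          using finite_has_minimal2[of "set_mset F" Z] \<open>Z \<in># F\<close> by auto
        then show ?thesis unfolding L_def by blast
      qed
      define F' where "F' = F - mset_set L"
      have F: "F = mset_set L + F'"
      proof -
        have "mset_set L \<subseteq># F"
        proof (rule subset_mset.order_trans)
          show "mset_set L \<subseteq># mset_set (set_mset F)"
            by (rule subset_imp_msubset_mset_set) (auto simp: L_def)
        qed (rule mset_set_set_mset_msubset)
        then show ?thesis by (simp add: F'_def)
      qed
      have "L \<noteq> {}"
        using False below by (metis empty_iff multiset_nonemptyE)
      define X where "X = S - \<Inter>L"
      have Lbound: "sum q L \<le> int (sum m X)"
      proof -
        have "L \<subseteq> Pow (S \<union> T)" "\<forall>Z\<in>L. Z \<inter> T \<noteq> {}"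
          using FV[OF LF] FT[OF LF] by auto
        moreover have "\<forall>Z\<in>L. \<forall>W\<in>L. Z \<noteq> W \<longrightarrow> Z \<inter> W \<inter> T = {}"
        proof (intro ballI impI)
          fix Z W assume "Z \<in> L" "W \<in> L" "Z \<noteq> W"
          then have "Z \<in># F" "W \<in># F" "\<not> Z \<subseteq> W" "\<not> W \<subseteq> Z"
            unfolding L_def by auto
          then show "Z \<inter> W \<inter> T = {}" using laminar by meson
        qed
        ultimately have "packing S T L"
          unfolding packing_def by (intro conjI)
        then show ?thesis
          using pack by (simp add: packing_bound_def X_def)
      qed
      define a' where "a' u = a u - (if u \<in> X then 1 else 0)" for u
      \<comment> \<open>Some member of \<open>L\<close> avoids \<open>u\<close>, and any of its
        nodes in \<open>T\<close> yields an edge from \<open>u\<close> that enters it. Hence the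
        truncated subtraction in \<open>a'\<close> is a true one.\<close>
      have a_pos: "a u \<ge> 1" if "u \<in> X" for u
      proof -
        obtain Z where Z: "Z \<in> L" "u \<notin> Z" "u \<in> S"
          using \<open>u \<in> X\<close> unfolding X_def by auto
        then obtain t where t: "t \<in> Z \<inter> T" "Z \<in># F"
          using FT[OF LF] LF by blast
        then have "Z \<in># {#Z \<in># F. entering (u, t) Z#}"
          using Z by (auto simp: entering_def)
        then have "size {#Z \<in># F. entering (u, t) Z#} \<ge> 1"
          by (metis One_nat_def Suc_leI empty_iff nonempty_has_size set_mset_empty)
        then show ?thesis
          using less.prems(2)[rule_format, of u t] Z t by simp
      qed
      have "(\<Sum>Z\<in>#F'. q Z) \<le> int (\<Sum>u\<in>S. m u * a' u)"
      proof (rule less.hyps)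
        obtain Z where Z: "Z \<in> L" using \<open>L \<noteq> {}\<close> by blast
        then have "Z \<in># F" by (simp add: L_def)
        then have "0 < sum ?w L"
          using w_pos[OF FV] Z \<open>finite L\<close> by (intro sum_pos2[of L Z]) auto
        moreover have "(\<Sum>Z\<in>#F. ?w Z) = sum ?w L + (\<Sum>Z\<in>#F'. ?w Z)"
          by (subst F) (simp add: sum_unfold_sum_mset)
        ultimately show "(\<Sum>Z\<in>#F'. ?w Z) < (\<Sum>Z\<in>#F. ?w Z)"
          by linarith
        show "\<forall>Z\<in>#F'. Z \<subseteq> S \<union> T \<and> Z \<inter> T \<noteq> {}"
          using less.prems(1) unfolding F'_def by (meson in_diffD)
        show "\<forall>u\<in>S. \<forall>t\<in>T. size {#Z \<in># F'. entering (u, t) Z#} \<le> a' u"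
        proof (intro ballI)
          fix u t assume u: "u \<in> S" and t: "t \<in> T"
          let ?N = "\<lambda>F t. size {#Z \<in># F. entering (u, t) Z#}"
          have split: "?N F t = ?N (mset_set L) t + ?N F' t"
            by (subst F) simp
          have le: "?N F t \<le> a u" using less.prems(2) u t by blast
          show "?N F' t \<le> a' u"
          proof (cases "u \<in> X")
            case False
            then show ?thesis using split le by (simp add: a'_def)
          next
            case True
            show ?thesis
            proof (cases "?N F t = 0")
              case True
              then show ?thesis using split by linarith
            next
              case False
              let ?E = "{Z \<in> set_mset F. entering (u, t) Z}"
              have "?E \<noteq> {}"
                using False by auto
              then obtain Z where Z: "Z \<in> ?E" "\<And>W. W \<in> ?E \<Longrightarrow> W \<subseteq> Z \<Longrightarrow> W = Z"
                using finite_has_minimal[of ?E] by auto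
              \<comment> \<open>All members entered by \<open>(u, t)\<close> contain
                \<open>t\<close>, so by laminarity they form a chain with \<open>Z\<close> at the
                bottom.\<close>
              have Zmin: "Z \<subseteq> W" if "W \<in> ?E" for W
                using laminar[of Z W] Z that t unfolding entering_def by fastforce
              obtain Z' where Z': "Z' \<in> L" "Z' \<subseteq> Z"
                using below Z by blast
              \<comment> \<open>\<open>Z'\<close> avoids \<open>u\<close> because \<open>Z\<close>
                does. If \<open>t \<in> Z'\<close>, the removed copy of \<open>Z'\<close> was
                counted at \<open>t\<close>, so the count drops.\<close>
              have "?N F' t + 1 \<le> a u"
              proof (cases "t \<in> Z'")
                case True
                then have "Z' \<in># {#Z \<in># mset_set L. entering (u, t) Z#}"
                  using Z Z' \<open>finite L\<close> by (auto simp: entering_def)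
                then have "?N (mset_set L) t \<ge> 1"
                  by (metis One_nat_def Suc_leI empty_iff nonempty_has_size set_mset_empty)
                then show ?thesis using split le by linarith
              next
                case False
                \<comment> \<open>Peeling need not lower the count at \<open>t\<close> now, but
                  there the bound was not attained: \<open>(u, t')\<close> enters every member that
                  \<open>(u, t)\<close> enters, since all of them contain \<open>Z'\<close>, and it
                  enters \<open>Z'\<close> in addition.\<close>
                obtain t' where t': "t' \<in> Z'" "t' \<in> T"
                  using FT[OF LF[OF Z'(1)]] by blast
                have "{#Z \<in># F. entering (u, t) Z#} \<subseteq># {#Z \<in># F. entering (u, t') Z#}"
                proof (rule mset_subset_eqI)
                  fix W
                  have "entering (u, t') W" if "W \<in># F" "entering (u, t) W"
                    using Zmin[of W] that Z' t' by (auto simp: entering_def)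
                  then show "count {#Z \<in># F. entering (u, t) Z#} W \<le>
                      count {#Z \<in># F. entering (u, t') Z#} W"
                    by (cases "W \<in># F") (auto simp: not_in_iff)
                qed
                moreover have "Z' \<in># {#Z \<in># F. entering (u, t') Z#}"
                  using Z Z' t' by (auto simp: entering_def L_def)
                moreover have "Z' \<notin># {#Z \<in># F. entering (u, t) Z#}"
                  using False by (simp add: entering_def)
                ultimately have "{#Z \<in># F. entering (u, t) Z#} \<subset># {#Z \<in># F. entering (u, t') Z#}"
                  by (metis subset_mset.le_imp_less_or_eq)
                then have "?N F t < ?N F t'"
                  by (rule mset_subset_size)
                also have "\<dots> \<le> a u" using less.prems(2) u t' by blast
                finally show ?thesis using split by linarith
              qed
              then show ?thesis using True by (simp add: a'_def)
            qed
          qed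
        qed
      qed
      moreover have "(\<Sum>Z\<in>#F. q Z) = sum q L + (\<Sum>Z\<in>#F'. q Z)"
        by (subst F) (simp add: sum_unfold_sum_mset)
      moreover have "(\<Sum>u\<in>S. m u * a u) = sum m X + (\<Sum>u\<in>S. m u * a' u)"
      proof -
        have "sum m X = (\<Sum>u\<in>S. if u \<in> X then m u else 0)"
          using fin by (simp add: X_def sum.If_cases Int_def set_diff_eq)
        moreover have "m u * a u = (if u \<in> X then m u else 0) + m u * a' u" for u
          using a_pos[of u] unfolding a'_def
          by (cases "a u") (auto simp: algebra_simps)
        ultimately show ?thesis by (simp add: sum.distrib)
      qed
      ultimately show ?thesis using Lbound by linarith
    qed
  qed
qed

section \<open>Choosing an edge that preserves the packing bound\<close>

lemma size_filter_mset_sum: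
  "finite I \<Longrightarrow> size (filter_mset P (\<Sum>i\<in>I. f i)) = (\<Sum>i\<in>I. size (filter_mset P (f i)))"
  by (induction I rule: finite_induct) auto

lemma sum_mset_image_sum:
  "finite I \<Longrightarrow> (\<Sum>x\<in>#(\<Sum>i\<in>I. f i). g x) = (\<Sum>i\<in>I. \<Sum>x\<in>#f i. g x)"
  by (induction I rule: finite_induct) auto

lemma sum_fun_upd_diff1:
  fixes f :: "'a \<Rightarrow> nat"
  assumes "finite A" "x \<in> A" "f x > 0"
  shows "Suc (sum (f(x := f x - 1)) A) = sum f A"
proof -
  have "sum (f(x := f x - 1)) (A - {x}) = sum f (A - {x})"
    by (rule sum.cong) auto
  then show ?thesis
    using assms sum.remove[of A x f] sum.remove[of A x "f(x := f x - 1)"] by simp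
qed

text \<open>One greedy step. The conclusion is the packing bound of the residual problem after
  adding \<open>(s, t)\<close>, so the step can be iterated.\<close>

lemma admissible_edge:
  fixes m :: "'v \<Rightarrow> nat"
  assumes fin: "finite S" "finite T"
    and super: "positively_supermodular_on S T q"
    and pack: "packing_bound S T q m"
    and t: "t \<in> T" "q {t} > 0"
  shows "\<exists>s\<in>S. m s > 0 \<and>
    packing_bound S T (\<lambda>Z. q Z - of_bool (entering (s, t) Z)) (m(s := m s - 1))"
proof (rule ccontr)
  assume neg: "\<not> ?thesis"
  define U where "U = {s \<in> S. m s > 0}"
  have "finite U" using fin by (simp add: U_def)
  have "\<exists>L. packing S T L \<and> sum q L = int (sum m (S - \<Inter>L)) \<and> s \<in> S - \<Inter>L \<and> (\<forall>Z\<in>L. \<not> entering (s, t) Z)"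
    if "s \<in> U" for s
  proof -
    have s: "s \<in> S" "m s > 0" using that by (auto simp: U_def)
    then have "\<not> packing_bound S T (\<lambda>Z. q Z - of_bool (entering (s, t) Z)) (m(s := m s - 1))"
      using neg by blast
    then obtain L where L: "packing S T L"
      and viol: "(\<Sum>Z\<in>L. q Z - of_bool (entering (s, t) Z)) >
        int (sum (m(s := m s - 1)) (S - \<Inter>L))"
      unfolding packing_bound_def by (auto simp: not_le)
    have "finite L" using L fin unfolding packing_def by (meson finite_Pow_iff finite_UnI finite_subset)
    define c where "c = card {Z \<in> L. entering (s, t) Z}"
    have q': "(\<Sum>Z\<in>L. q Z - of_bool (entering (s, t) Z)) = sum q L - int c"
      using \<open>finite L\<close> by (simp add: sum_subtractf c_def Int_def)
    have m': "sum (m(s := m s - 1)) (S - \<Inter>L) + of_bool (s \<in> S - \<Inter>L) = sum m (S - \<Inter>L)"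
    proof (cases "s \<in> S - \<Inter>L")
      case True
      then show ?thesis
        using sum_fun_upd_diff1[of "S - \<Inter>L" s m] fin s by simp
    next
      case False
      then have "sum (m(s := m s - 1)) (S - \<Inter>L) = sum m (S - \<Inter>L)"
        by (intro sum.cong) auto
      then show ?thesis using False by simp
    qed
    have le: "sum q L \<le> int (sum m (S - \<Inter>L))"
      using pack L by (simp add: packing_bound_def)
    \<comment> \<open>Adding \<open>(s, t)\<close> lowers the left side by \<open>c\<close> and the
      right side by one or zero. An integer inequality that held before can fail only if it was
      tight, \<open>c = 0\<close>, and the right side did drop.\<close>
    have "c = 0" "s \<in> S - \<Inter>L" "sum q L = int (sum m (S - \<Inter>L))"
    proof -
      have "int (sum (m(s := m s - 1)) (S - \<Inter>L)) + of_bool (s \<in> S - \<Inter>L) =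
          int (sum m (S - \<Inter>L))"
        unfolding m'[symmetric] by simp
      then show "c = 0" "s \<in> S - \<Inter>L" "sum q L = int (sum m (S - \<Inter>L))"
        using viol le unfolding q' by (cases "s \<in> S - \<Inter>L"; simp del: Diff_iff fun_upd_apply)+
    qed
    moreover from this have "\<forall>Z\<in>L. \<not> entering (s, t) Z"
      using \<open>finite L\<close> unfolding c_def by auto
    ultimately show ?thesis using L by blast
  qed
  then obtain L where packing: "\<And>s. s \<in> U \<Longrightarrow> packing S T (L s)"
    and tight: "\<And>s. s \<in> U \<Longrightarrow> sum q (L s) = int (sum m (S - \<Inter>(L s)))"
    and s_out: "\<And>s. s \<in> U \<Longrightarrow> s \<in> S - \<Inter>(L s)"
    and not_entering: "\<And>s Z. s \<in> U \<Longrightarrow> Z \<in> L s \<Longrightarrow> \<not> entering (s, t) Z"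
    by metis
  have finL: "finite (L s)" if "s \<in> U" for s
    using packing[OF that] fin unfolding packing_def by (meson finite_Pow_iff finite_UnI finite_subset)
  define F where "F = {#{t}#} + (\<Sum>s\<in>U. mset_set (L s))"
  \<comment> \<open>Each tight packing contributes the indicator of its own
    \<open>S - \<Inter>(L s)\<close>. Nodes outside \<open>U\<close> get one more unit to pay for
    \<open>{t}\<close>; it costs nothing because \<open>m\<close> vanishes on
    \<open>S - U\<close>.\<close>
  define a :: "'v \<Rightarrow> nat" where "a u = (\<Sum>s\<in>U. of_bool (u \<in> S - \<Inter>(L s))) + of_bool (u \<notin> U)" for u
  have "(\<Sum>Z\<in>#F. q Z) \<le> int (\<Sum>u\<in>S. m u * a u)"
  proof (rule family_bound[OF fin super pack])
    show "\<forall>Z\<in>#F. Z \<subseteq> S \<union> T \<and> Z \<inter> T \<noteq> {}"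
    proof
      fix Z assume "Z \<in># F"
      then have "Z = {t} \<or> (\<exists>s\<in>U. Z \<in> L s)"
        unfolding F_def using \<open>finite U\<close> finL by (auto simp: set_mset_sum)
      then show "Z \<subseteq> S \<union> T \<and> Z \<inter> T \<noteq> {}"
        using t packing unfolding packing_def by blast
    qed
    show "\<forall>u\<in>S. \<forall>v\<in>T. size {#Z \<in># F. entering (u, v) Z#} \<le> a u"
    proof (intro ballI)
      fix u v assume u: "u \<in> S" and v: "v \<in> T"
      let ?n = "\<lambda>s. size {#Z \<in># mset_set (L s). entering (u, v) Z#}"
      \<comment> \<open>Members of one packing are disjoint inside \<open>T\<close>, so
        \<open>(u, v)\<close> enters at most one of them.\<close>
      have n: "?n s \<le> of_bool (u \<in> S - \<Inter>(L s))" if "s \<in> U" for s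
      proof (cases "{Z \<in> L s. entering (u, v) Z} = {}")
        case True
        then have "?n s = 0" using finL[OF that] by (metis card.empty filter_mset_mset_set size_mset_set)
        then show ?thesis by linarith
      next
        case False
        then obtain Z where Z: "Z \<in> L s" "entering (u, v) Z" by blast
        then have "{Z \<in> L s. entering (u, v) Z} = {Z}"
          using packing[OF that] v unfolding entering_def packing_def by fastforce
        moreover have "u \<in> S - \<Inter>(L s)"
          using Z u by (auto simp: entering_def)
        ultimately show ?thesis using finL[OF that] by simp
      qed
      have size: "size {#Z \<in># F. entering (u, v) Z#} = of_bool (entering (u, v) {t}) + sum ?n U"
        unfolding F_def using \<open>finite U\<close> by (simp add: size_filter_mset_sum)
      show "size {#Z \<in># F. entering (u, v) Z#} \<le> a u"
      proof (cases "u \<in> U \<and> v = t")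
        case False
        have "sum ?n U \<le> (\<Sum>s\<in>U. of_bool (u \<in> S - \<Inter>(L s)))"
          using n by (rule sum_mono)
        moreover have "of_bool (entering (u, v) {t}) \<le> (of_bool (u \<notin> U) :: nat)"
          using False by (auto simp: entering_def)
        ultimately show ?thesis unfolding size a_def by linarith
      next
        \<comment> \<open>The edge \<open>(u, t)\<close> enters no member of \<open>L u\<close>, yet
          \<open>a u\<close> has a unit for \<open>L u\<close>, as \<open>u\<close> lies outside
          \<open>\<Inter>(L u)\<close>. This spare unit pays for \<open>{t}\<close>.\<close>
        case True
        have "sum ?n U = ?n u + sum ?n (U - {u})"
          using True \<open>finite U\<close> by (intro sum.remove) auto
        moreover have "?n u = 0"
          using True not_entering finL by auto
        moreover have "sum ?n (U - {u}) \<le> (\<Sum>s\<in>U - {u}. of_bool (u \<in> S - \<Inter>(L s)))"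
          by (rule sum_mono) (use n in blast)
        moreover have "(\<Sum>s\<in>U. of_bool (u \<in> S - \<Inter>(L s))) =
            (1::nat) + (\<Sum>s\<in>U - {u}. of_bool (u \<in> S - \<Inter>(L s)))"
          using True s_out[of u] by (subst sum.remove[OF \<open>finite U\<close>, of u]) auto
        ultimately show ?thesis unfolding size a_def by (simp add: of_bool_def)
      qed
    qed
  qed
  moreover have "(\<Sum>Z\<in>#F. q Z) = q {t} + (\<Sum>s\<in>U. int (sum m (S - \<Inter>(L s))))"
    unfolding F_def using \<open>finite U\<close> tight
    by (simp add: sum_mset_image_sum sum_unfold_sum_mset[symmetric])
  \<comment> \<open>By tightness the packings contribute equally to both sides of the bound, which
    leaves \<open>q {t} \<le> 0\<close>.\<close>
  moreover have "(\<Sum>u\<in>S. m u * a u) = (\<Sum>s\<in>U. sum m (S - \<Inter>(L s)))"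
  proof -
    have "(\<Sum>u\<in>S. m u * a u) = (\<Sum>u\<in>S. \<Sum>s\<in>U. m u * of_bool (u \<in> S - \<Inter>(L s)))"
    proof (rule sum.cong[OF refl])
      fix u assume "u \<in> S"
      then have "m u * of_bool (u \<notin> U) = 0" by (auto simp: U_def)
      then show "m u * a u = (\<Sum>s\<in>U. m u * of_bool (u \<in> S - \<Inter>(L s)))"
        unfolding a_def by (simp add: distrib_left sum_distrib_left)
    qed
    also have "\<dots> = (\<Sum>s\<in>U. \<Sum>u\<in>S. m u * of_bool (u \<in> S - \<Inter>(L s)))"
      by (rule sum.swap)
    also have "\<dots> = (\<Sum>s\<in>U. sum m (S - \<Inter>(L s)))"
    proof (rule sum.cong[OF refl])
      fix s
      have "sum m (S - \<Inter>(L s)) = (\<Sum>u\<in>S - \<Inter>(L s). m u * of_bool (u \<in> S - \<Inter>(L s)))"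
        by (rule sum.cong) auto
      also have "\<dots> = (\<Sum>u\<in>S. m u * of_bool (u \<in> S - \<Inter>(L s)))"
        using fin by (intro sum.mono_neutral_left) auto
      finally show "(\<Sum>u\<in>S. m u * of_bool (u \<in> S - \<Inter>(L s))) = sum m (S - \<Inter>(L s))" ..
    qed
    finally show ?thesis .
  qed
  ultimately show False using t by simp
qed

section \<open>Greedy construction of a bigraph meeting all demands\<close>

text \<open>The subtracted indicator is submodular, and a positive residual demand was positive
  before.\<close>

lemma positively_supermodular_on_minus_entering:
  assumes "positively_supermodular_on S T q"
  shows "positively_supermodular_on S T (\<lambda>Z. q Z - of_bool (entering e Z))"
  unfolding positively_supermodular_on_def
proof (intro allI impI, elim conjE)
  fix Z W
  assume ZW: "Z \<subseteq> S \<union> T" "W \<subseteq> S \<union> T" "Z \<inter> W \<inter> T \<noteq> {}"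
    and "0 < q Z - of_bool (entering e Z)" "0 < q W - of_bool (entering e W)"
  then have "q Z > 0" "q W > 0" by (auto simp: of_bool_def split: if_splits)
  then have "q Z + q W \<le> q (Z \<inter> W) + q (Z \<union> W)"
    using assms ZW unfolding positively_supermodular_on_def by blast
  moreover have "(of_bool (entering e (Z \<inter> W)) :: int) + of_bool (entering e (Z \<union> W))
      \<le> of_bool (entering e Z) + of_bool (entering e W)"
    by (auto simp: entering_def)
  ultimately show "q Z - of_bool (entering e Z) + (q W - of_bool (entering e W))
      \<le> q (Z \<inter> W) - of_bool (entering e (Z \<inter> W)) + (q (Z \<union> W) - of_bool (entering e (Z \<union> W)))"
    by linarith
qed

text \<open>Induction on the number of edges still to be placed. The function \<open>b\<close> holds
  the remaining degrees on \<open>T\<close>; its balance with \<open>m\<close> guarantees a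
  singleton of positive demand while edges remain. Parallel edges are not excluded here: simplicity
  will be encoded in the choice of \<open>q\<close>.\<close>

lemma covering_bigraph_exists:
  fixes m b :: "'v \<Rightarrow> nat"
  assumes fin: "finite S" "finite T" and disj: "S \<inter> T = {}"
  shows "positively_supermodular_on S T q \<Longrightarrow> packing_bound S T q m \<Longrightarrow>
    (\<forall>t\<in>T. q {t} = int (b t)) \<Longrightarrow> sum b T = sum m S \<Longrightarrow>
    \<exists>G. is_bigraph S T G \<and> (\<forall>s\<in>S. size {#e \<in># G. fst e = s#} = m s) \<and>
      (\<forall>Z\<subseteq>S \<union> T. Z \<inter> T \<noteq> {} \<longrightarrow> q Z \<le> int (size {#e \<in># G. entering e Z#}))"
proof (induction "sum m S" arbitrary: m b q)
  case 0
  then have m0: "\<forall>s\<in>S. m s = 0" using fin by simp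
  have "q Z \<le> 0" if "Z \<subseteq> S \<union> T" "Z \<inter> T \<noteq> {}" for Z
  proof -
    \<comment> \<open>A single set is a packing, so no demand is positive once \<open>m\<close>
      vanishes on \<open>S\<close>.\<close>
    have "sum q {Z} \<le> int (sum m (S - \<Inter>{Z}))"
      using \<open>packing_bound S T q m\<close> that unfolding packing_bound_def
      by (elim allE[of _ "{Z}"]) (simp add: packing_def)
    then show ?thesis using m0 by simp
  qed
  then show ?case
    using m0 by (intro exI[of _ "{#}"]) (auto simp: is_bigraph_def)
next
  case (Suc n)
  obtain t where t: "t \<in> T" "b t > 0"
    using Suc.hyps(2) Suc.prems(4) by (metis gr0I sum.neutral nat.distinct(1))
  then obtain s where s: "s \<in> S" "m s > 0" and
    pack: "packing_bound S T (\<lambda>Z. q Z - of_bool (entering (s, t) Z)) (m(s := m s - 1))"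
    using admissible_edge[OF fin Suc.prems(1,2), of t] Suc.prems(3) by auto
  let ?q = "\<lambda>Z. q Z - of_bool (entering (s, t) Z)"
  let ?m = "m(s := m s - 1)" and ?b = "b(t := b t - 1)"
  have "\<exists>G. is_bigraph S T G \<and> (\<forall>s\<in>S. size {#e \<in># G. fst e = s#} = ?m s) \<and>
      (\<forall>Z\<subseteq>S \<union> T. Z \<inter> T \<noteq> {} \<longrightarrow> ?q Z \<le> int (size {#e \<in># G. entering e Z#}))"
  proof (rule Suc.hyps(1))
    show "n = sum ?m S" using sum_fun_upd_diff1[where f = m, OF fin(1) s] Suc.hyps(2) by linarith
    show "positively_supermodular_on S T ?q"
      by (rule positively_supermodular_on_minus_entering) fact
    show "packing_bound S T ?q ?m" by (rule pack)
    show "\<forall>v\<in>T. ?q {v} = int (?b v)"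
      using Suc.prems(3) t s disj by (auto simp: entering_def of_nat_diff)
    show "sum ?b T = sum ?m S"
      using sum_fun_upd_diff1[where f = m, OF fin(1) s] sum_fun_upd_diff1[where f = b, OF fin(2) t] Suc.prems(4) by linarith
  qed
  then obtain G where G: "is_bigraph S T G" "\<forall>s\<in>S. size {#e \<in># G. fst e = s#} = ?m s"
    "\<forall>Z\<subseteq>S \<union> T. Z \<inter> T \<noteq> {} \<longrightarrow> ?q Z \<le> int (size {#e \<in># G. entering e Z#})"
    by blast
  show ?case
  proof (intro exI[of _ "add_mset (s, t) G"] conjI ballI allI impI)
    show "is_bigraph S T (add_mset (s, t) G)"
      using G(1) s t by (simp add: is_bigraph_def)
    show "size {#e \<in># add_mset (s, t) G. fst e = u#} = m u" if "u \<in> S" for u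
      using G(2) that s by auto
    show "q Z \<le> int (size {#e \<in># add_mset (s, t) G. entering e Z#})"
      if "Z \<subseteq> S \<union> T" "Z \<inter> T \<noteq> {}" for Z
      using G(3)[rule_format, OF that] by (auto split: if_splits)
  qed
qed

section \<open>Rank and degree demands and their supermodularity\<close>

lemma rank_Un_le:
  assumes "matroid S r" "B \<subseteq> S" "C \<subseteq> S"
  shows "r (B \<union> C) \<le> r B + card C"
proof -
  have "r (B \<inter> C) + r (B \<union> C) \<le> r B + r C" "r C \<le> card C"
    using assms unfolding matroid_def by auto
  then show ?thesis by linarith
qed

lemma rank_mono:
  assumes "matroid S r" "B \<subseteq> C" "C \<subseteq> S"
  shows "r B \<le> r C"
  using assms unfolding matroid_def by blast

lemma neighbours_subset:
  assumes "is_bigraph S T H"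
  shows "neighbours H A \<subseteq> S"
  using assms unfolding is_bigraph_def neighbours_def by blast

lemma edges_between_bip_complement:
  assumes "finite S" "finite T" "X \<subseteq> S" "Y \<subseteq> T"
  shows "edges_between (bip_complement S T H) X Y = card {e \<in> X \<times> Y. e \<notin># H}"
proof -
  have "{e \<in> {e \<in> S \<times> T. e \<notin># H}. fst e \<in> X \<and> snd e \<in> Y} = {e \<in> X \<times> Y. e \<notin># H}"
    using assms by auto
  then show ?thesis
    using assms unfolding edges_between_def bip_complement_def by simp
qed

text \<open>An edge entering \<open>Z\<close> adds at most one node to
  \<open>Z \<inter> S \<union> neighbours H (Z \<inter> T)\<close>, and so at most one to the rank.
  The missing rank is thus a lower bound on the number of entering edges.\<close>

definition rank_demand ::
    "'v set \<Rightarrow> 'v set \<Rightarrow> 'v bigraph \<Rightarrow> ('v set \<Rightarrow> nat) \<Rightarrow> ('v set \<Rightarrow> int) \<Rightarrow> 'v set \<Rightarrow> int" where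
  "rank_demand S T H r p Z = p (Z \<inter> T) - int (r (Z \<inter> S \<union> neighbours H (Z \<inter> T)))"

definition degree_demand ::
    "'v set \<Rightarrow> 'v set \<Rightarrow> 'v bigraph \<Rightarrow> ('v \<Rightarrow> nat) \<Rightarrow> 'v set \<Rightarrow> int" where
  "degree_demand S T H m Z =
     int (sum m (Z \<inter> T)) - int (card {e \<in> (Z \<inter> S) \<times> (Z \<inter> T). e \<notin># H})"

text \<open>The subtracted number of available pairs is supermodular in the pair of sets, so
  \<open>degree_demand\<close> bends the wrong way in general. With the part in \<open>T\<close>
  fixed to a single node it is modular, hence the restriction to singletons.\<close>

definition demand ::
    "'v set \<Rightarrow> 'v set \<Rightarrow> 'v bigraph \<Rightarrow> ('v set \<Rightarrow> nat) \<Rightarrow> ('v set \<Rightarrow> int) \<Rightarrow> ('v \<Rightarrow> nat) \<Rightarrow>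
     'v set \<Rightarrow> int" where
  "demand S T H r p m Z =
     (if is_singleton (Z \<inter> T) then max (rank_demand S T H r p Z) (degree_demand S T H m Z)
      else rank_demand S T H r p Z)"

lemma degree_demand_singleton:
  assumes "Z \<inter> T = {t}"
  shows "degree_demand S T H m Z = int (m t) - int (card {s \<in> Z \<inter> S. (s, t) \<notin># H})"
proof -
  have "{e \<in> (Z \<inter> S) \<times> {t}. e \<notin># H} = (\<lambda>s. (s, t)) ` {s \<in> Z \<inter> S. (s, t) \<notin># H}"
    by auto
  then show ?thesis
    unfolding degree_demand_def assms by (simp add: card_image inj_on_def)
qed

text \<open>Neighbourhoods commute with unions and are only included in the intersection, so
  submodularity and monotonicity of \<open>r\<close> handle the rank term.\<close>

lemma rank_demand_supermodular:
  assumes mat: "matroid S r" and H: "is_bigraph S T H"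
    and p: "positively_intersecting_supermodular T p"
    and ZW: "Z \<inter> W \<inter> T \<noteq> {}" "rank_demand S T H r p Z > 0" "rank_demand S T H r p W > 0"
  shows "rank_demand S T H r p Z + rank_demand S T H r p W
    \<le> rank_demand S T H r p (Z \<inter> W) + rank_demand S T H r p (Z \<union> W)"
proof -
  let ?N = "\<lambda>Z. Z \<inter> S \<union> neighbours H (Z \<inter> T)"
  have sub: "?N Z \<subseteq> S" for Z
    using neighbours_subset[OF H] by auto
  have "?N (Z \<union> W) = ?N Z \<union> ?N W" "?N (Z \<inter> W) \<subseteq> ?N Z \<inter> ?N W"
    unfolding neighbours_def by blast+
  moreover have "r (?N Z \<inter> ?N W) + r (?N Z \<union> ?N W) \<le> r (?N Z) + r (?N W)"
    using mat sub[of Z] sub[of W] unfolding matroid_def by blast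
  moreover have "r (?N (Z \<inter> W)) \<le> r (?N Z \<inter> ?N W)"
    using \<open>?N (Z \<inter> W) \<subseteq> ?N Z \<inter> ?N W\<close> sub[of Z] by (intro rank_mono[OF mat]) blast+
  ultimately have "r (?N (Z \<inter> W)) + r (?N (Z \<union> W)) \<le> r (?N Z) + r (?N W)"
    by simp
  moreover have "p (Z \<inter> T) + p (W \<inter> T) \<le> p (Z \<inter> W \<inter> T) + p ((Z \<union> W) \<inter> T)"
  proof -
    have eq: "Z \<inter> W \<inter> T = (Z \<inter> T) \<inter> (W \<inter> T)" "(Z \<union> W) \<inter> T = (Z \<inter> T) \<union> (W \<inter> T)"
      by blast+
    have "p (Z \<inter> T) > 0" "p (W \<inter> T) > 0"
      using ZW(2,3) unfolding rank_demand_def by linarith+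
    show ?thesis
    \<comment> \<open>Comparable sets give equality. Otherwise the assumption on \<open>p\<close>
      applies, since a positive rank demand forces \<open>p\<close> to be positive.\<close>
    proof (cases "Z \<inter> T \<subseteq> W \<inter> T \<or> W \<inter> T \<subseteq> Z \<inter> T")
      case True
      then show ?thesis unfolding eq by (auto simp: inf_absorb1 inf_absorb2 sup_absorb1 sup_absorb2)
    next
      case False
      then show ?thesis
        using p[unfolded positively_intersecting_supermodular_def, rule_format, of "Z \<inter> T" "W \<inter> T"]
          ZW(1) \<open>p (Z \<inter> T) > 0\<close> \<open>p (W \<inter> T) > 0\<close> unfolding eq by simp
    qed
  qed
  ultimately show ?thesis unfolding rank_demand_def by linarith
qed

text \<open>The degree demand passes to the intersection and the rank demand to the union. Passing
  from \<open>W\<close> to \<open>Z \<union> W\<close> adds only nodes of \<open>Z - W\<close> not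
  joined to \<open>t\<close> by \<open>H\<close>, since the others are already neighbours of
  \<open>W \<inter> T\<close>. The possible gain in rank is exactly what the degree demand gains on
  \<open>Z \<inter> W\<close>.\<close>

lemma degree_rank_demand_supermodular:
  assumes fin: "finite S" and mat: "matroid S r" and H: "is_bigraph S T H"
    and Z: "Z \<inter> T = {t}" and W: "t \<in> W" "t \<in> T"
  shows "degree_demand S T H m Z + rank_demand S T H r p W
    \<le> degree_demand S T H m (Z \<inter> W) + rank_demand S T H r p (Z \<union> W)"
proof -
  let ?N = "\<lambda>Z. Z \<inter> S \<union> neighbours H (Z \<inter> T)"
  let ?D = "\<lambda>Z. {s \<in> Z \<inter> S. (s, t) \<notin># H}"
  have ZWT: "Z \<inter> W \<inter> T = {t}" and UT: "(Z \<union> W) \<inter> T = W \<inter> T"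
    using Z W by (auto simp: Int_Un_distrib2)
  have sub: "?N Z \<subseteq> S" for Z
    using neighbours_subset[OF H] by auto
  have "?N (Z \<union> W) \<subseteq> ?N W \<union> ?D (Z - W)"
    unfolding UT using W by (auto simp: neighbours_def)
  then have "r (?N (Z \<union> W)) \<le> r (?N W \<union> ?D (Z - W))"
    using sub by (intro rank_mono[OF mat]) auto
  also have "\<dots> \<le> r (?N W) + card (?D (Z - W))"
    using sub by (intro rank_Un_le[OF mat]) auto
  finally have "r (?N (Z \<union> W)) \<le> r (?N W) + card (?D (Z - W))" .
  moreover have "card (?D Z) = card (?D (Z \<inter> W)) + card (?D (Z - W))"
  proof -
    have "?D Z = ?D (Z \<inter> W) \<union> ?D (Z - W)" by blast
    then show ?thesis using fin by (simp only: card_Un_disjoint) (subst card_Un_disjoint, auto)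
  qed
  ultimately show ?thesis
    unfolding degree_demand_singleton[OF Z] degree_demand_singleton[OF ZWT] rank_demand_def UT
    by linarith
qed

lemma degree_demand_modular:
  assumes fin: "finite S" and Z: "Z \<inter> T = {t}" and W: "W \<inter> T = {t}"
  shows "degree_demand S T H m Z + degree_demand S T H m W
    = degree_demand S T H m (Z \<inter> W) + degree_demand S T H m (Z \<union> W)"
proof -
  let ?D = "\<lambda>Z. {s \<in> Z \<inter> S. (s, t) \<notin># H}"
  have ZWT: "Z \<inter> W \<inter> T = {t}" and UT: "(Z \<union> W) \<inter> T = {t}"
    using Z W by blast+
  have "?D (Z \<inter> W) = ?D Z \<inter> ?D W" "?D (Z \<union> W) = ?D Z \<union> ?D W" by blast+
  then have "card (?D Z) + card (?D W) = card (?D (Z \<inter> W)) + card (?D (Z \<union> W))"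
    using card_Un_Int[of "?D Z" "?D W"] fin by simp
  then show ?thesis
    unfolding degree_demand_singleton[OF Z] degree_demand_singleton[OF W]
      degree_demand_singleton[OF ZWT] degree_demand_singleton[OF UT]
    by linarith
qed

text \<open>The case split is on which of the two demands attains the value on \<open>Z\<close> and
  on \<open>W\<close>.\<close>

lemma demand_supermodular:
  assumes fin: "finite S" and mat: "matroid S r" and H: "is_bigraph S T H"
    and p: "positively_intersecting_supermodular T p"
  shows "positively_supermodular_on S T (demand S T H r p m)"
  unfolding positively_supermodular_on_def
proof (intro allI impI, elim conjE)
  fix Z W
  let ?q = "demand S T H r p m" and ?k = "rank_demand S T H r p" and ?l = "degree_demand S T H m"
  assume ZW: "Z \<inter> W \<inter> T \<noteq> {}" and pos: "?q Z > 0" "?q W > 0"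
  have k_le: "?k A \<le> ?q A" for A by (simp add: demand_def)
  have l_le: "?l A \<le> ?q A" if "A \<inter> T = {t}" for A t
    using that by (simp add: demand_def)
  have cases: "?q A = ?k A \<or> (\<exists>t. A \<inter> T = {t} \<and> ?q A = ?l A)" for A
    by (auto simp: demand_def is_singleton_def max_def)
  have mixed: "?q A + ?q B \<le> ?q (A \<inter> B) + ?q (A \<union> B)"
    if "A \<inter> B \<inter> T \<noteq> {}" "A \<inter> T = {t}" "?q A = ?l A" "?q B = ?k B" for A B t
  proof -
    have "A \<inter> B \<inter> T = {t} \<inter> B" unfolding that(2)[symmetric] by blast
    then have "t \<in> B" "t \<in> T" "A \<inter> B \<inter> T = {t}" using that by auto
    then show ?thesis
      using degree_rank_demand_supermodular[OF fin mat H \<open>A \<inter> T = {t}\<close>, of B m p]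
        k_le[of "A \<union> B"] l_le[of "A \<inter> B" t] that by linarith
  qed
  consider "?q Z = ?k Z" "?q W = ?k W"
    | t where "Z \<inter> T = {t}" "?q Z = ?l Z" "?q W = ?k W"
    | t where "W \<inter> T = {t}" "?q W = ?l W" "?q Z = ?k Z"
    | t t' where "Z \<inter> T = {t}" "?q Z = ?l Z" "W \<inter> T = {t'}" "?q W = ?l W"
    using cases[of Z] cases[of W] by blast
  then show "?q Z + ?q W \<le> ?q (Z \<inter> W) + ?q (Z \<union> W)"
  proof cases
    case 1
    then show ?thesis
      using rank_demand_supermodular[OF mat H p ZW] pos k_le[of "Z \<inter> W"] k_le[of "Z \<union> W"]
      by linarith
  next
    case 2
    then show ?thesis using mixed[of Z W] ZW by blast
  next
    case 3
    then show ?thesis using mixed[of W Z] ZW by (simp add: Int_commute Un_commute add.commute)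
  next
    case 4
    \<comment> \<open>Two singletons that meet coincide, so the modular case applies.\<close>
    have "Z \<inter> W \<inter> T = {t} \<inter> {t'}" "(Z \<union> W) \<inter> T = {t} \<union> {t'}"
      unfolding 4(1)[symmetric] 4(3)[symmetric] by blast+
    then have "Z \<inter> W \<inter> T = {t}" "(Z \<union> W) \<inter> T = {t}" "W \<inter> T = {t}"
      using ZW 4(3) by (auto split: if_splits)
    then show ?thesis
      using degree_demand_modular[OF fin 4(1), of W H m] 4 l_le[of "Z \<inter> W" t] l_le[of "Z \<union> W" t]
      by linarith
  qed
qed

section \<open>From the inequality of the theorem to the packing bound\<close>

text \<open>Shrinking the part of every member in \<open>S\<close> to the common part
  \<open>X\<close> only raises the two demands. The hypothesis for \<open>X\<close> then bounds the
  total, and moving \<open>sum m X\<close> to the right leaves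
  \<open>sum m (S - \<Inter>L)\<close>.\<close>

lemma demand_packing_bound:
  fixes m :: "'v \<Rightarrow> nat"
  assumes fin: "finite S" "finite T" and mat: "matroid S r" and H: "is_bigraph S T H"
    and cond: "\<And>X Y P. X \<subseteq> S \<Longrightarrow> Y \<subseteq> T \<Longrightarrow> subpartition (T - Y) P \<Longrightarrow>
      int (sum m X) + int (sum m Y) - int (card {e \<in> X \<times> Y. e \<notin># H})
        + (\<Sum>A\<in>P. p A - int (r (X \<union> neighbours H A))) \<le> int (sum m S)"
  shows "packing_bound S T (demand S T H r p m) m"
  unfolding packing_bound_def
proof (intro allI impI)
  fix L assume "packing S T L"
  then have LV: "\<And>Z. Z \<in> L \<Longrightarrow> Z \<subseteq> S \<union> T" and LT: "\<And>Z. Z \<in> L \<Longrightarrow> Z \<inter> T \<noteq> {}"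
    and disj: "\<And>Z W. Z \<in> L \<Longrightarrow> W \<in> L \<Longrightarrow> Z \<noteq> W \<Longrightarrow> Z \<inter> W \<inter> T = {}"
    unfolding packing_def by auto
  have "finite L"
    using LV fin by (intro finite_subset[of L "Pow (S \<union> T)"]) auto
  let ?q = "demand S T H r p m" and ?k = "rank_demand S T H r p" and ?l = "degree_demand S T H m"
  \<comment> \<open>On \<open>L2\<close> the degree demand exceeds the rank demand, so these members
    meet \<open>T\<close> in single nodes, which make up \<open>Y\<close>. The other members supply
    the subpartition \<open>P\<close>.\<close>
  define L2 where "L2 = {Z \<in> L. ?q Z \<noteq> ?k Z}"
  define L1 where "L1 = L - L2"
  define X where "X = S \<inter> \<Inter>L"
  define Y where "Y = (\<Union>Z\<in>L2. Z \<inter> T)"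
  define P where "P = (\<lambda>Z. Z \<inter> T) ` L1"
  have fin12: "finite L1" "finite L2"
    using \<open>finite L\<close> by (auto simp: L1_def L2_def)
  have L12: "L1 \<subseteq> L" "L2 \<subseteq> L" "L1 \<inter> L2 = {}"
    by (auto simp: L1_def L2_def)
  have "inj_on (\<lambda>Z. Z \<inter> T) L1"
  proof (rule inj_onI, rule ccontr)
    fix Z W assume "Z \<in> L1" "W \<in> L1" "Z \<inter> T = W \<inter> T" "Z \<noteq> W"
    then show False using disj[of Z W] LT[of Z] L12 by blast
  qed
  then have sum_P: "(\<Sum>A\<in>P. p A - int (r (X \<union> neighbours H A))) =
      (\<Sum>Z\<in>L1. p (Z \<inter> T) - int (r (X \<union> neighbours H (Z \<inter> T))))"
    unfolding P_def by (simp add: sum.reindex)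
  have "subpartition (T - Y) P"
    unfolding subpartition_def
  proof (intro conjI)
    show "\<Union>P \<subseteq> T - Y"
    proof
      fix v assume "v \<in> \<Union>P"
      then obtain Z where Z: "Z \<in> L1" "v \<in> Z" "v \<in> T" unfolding P_def by blast
      have "v \<notin> W" if "W \<in> L2" for W
        using disj[of Z W] Z that L12 by blast
      then show "v \<in> T - Y" using Z unfolding Y_def by blast
    qed
    show "disjoint P"
      unfolding P_def disjoint_def using disj L12 by blast
    show "{} \<notin> P" using LT L12 unfolding P_def by fastforce
  qed
  then have main: "int (sum m X) + int (sum m Y) - int (card {e \<in> X \<times> Y. e \<notin># H})
      + (\<Sum>Z\<in>L1. p (Z \<inter> T) - int (r (X \<union> neighbours H (Z \<inter> T)))) \<le> int (sum m S)"
    using cond[of X Y P] unfolding sum_P by (auto simp: X_def Y_def)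
  have "sum ?q L1 \<le> (\<Sum>Z\<in>L1. p (Z \<inter> T) - int (r (X \<union> neighbours H (Z \<inter> T))))"
  proof (rule sum_mono)
    fix Z assume "Z \<in> L1"
    then have "?q Z = ?k Z" and "X \<subseteq> Z \<inter> S"
      by (auto simp: L1_def L2_def X_def)
    moreover from this have "r (X \<union> neighbours H (Z \<inter> T)) \<le> r (Z \<inter> S \<union> neighbours H (Z \<inter> T))"
      using neighbours_subset[OF H] by (intro rank_mono[OF mat]) auto
    ultimately show "?q Z \<le> p (Z \<inter> T) - int (r (X \<union> neighbours H (Z \<inter> T)))"
      by (simp add: rank_demand_def)
  qed
  moreover have "sum ?q L2 \<le> int (sum m Y) - int (card {e \<in> X \<times> Y. e \<notin># H})"
  proof -
    have "sum ?q L2 \<le> (\<Sum>Z\<in>L2. int (sum m (Z \<inter> T)) - int (card {e \<in> X \<times> (Z \<inter> T). e \<notin># H}))"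
    proof (rule sum_mono)
      fix Z assume Z: "Z \<in> L2"
      then have "?q Z = ?l Z"
        by (auto simp: L2_def demand_def max_def split: if_splits)
      moreover have "X \<subseteq> Z \<inter> S" using Z by (auto simp: L2_def X_def)
      then have "card {e \<in> X \<times> (Z \<inter> T). e \<notin># H} \<le> card {e \<in> (Z \<inter> S) \<times> (Z \<inter> T). e \<notin># H}"
        using fin by (intro card_mono) auto
      ultimately show "?q Z \<le> int (sum m (Z \<inter> T)) - int (card {e \<in> X \<times> (Z \<inter> T). e \<notin># H})"
        by (simp add: degree_demand_def)
    qed
    also have "\<dots> = int (\<Sum>Z\<in>L2. sum m (Z \<inter> T)) - int (\<Sum>Z\<in>L2. card {e \<in> X \<times> (Z \<inter> T). e \<notin># H})"
      by (simp add: sum_subtractf)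
    also have "(\<Sum>Z\<in>L2. sum m (Z \<inter> T)) = sum m Y"
      unfolding Y_def
    proof (rule sum.UNION_disjoint[symmetric])
      show "\<forall>Z\<in>L2. \<forall>W\<in>L2. Z \<noteq> W \<longrightarrow> Z \<inter> T \<inter> (W \<inter> T) = {}"
        using disj L12 by blast
    qed (use fin fin12 in auto)
    finally have "sum ?q L2 \<le>
        int (sum m Y) - int (\<Sum>Z\<in>L2. card {e \<in> X \<times> (Z \<inter> T). e \<notin># H})" .
    moreover have "card {e \<in> X \<times> Y. e \<notin># H} \<le> (\<Sum>Z\<in>L2. card {e \<in> X \<times> (Z \<inter> T). e \<notin># H})"
    proof -
      have "{e \<in> X \<times> Y. e \<notin># H} = (\<Union>Z\<in>L2. {e \<in> X \<times> (Z \<inter> T). e \<notin># H})"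
        unfolding Y_def by auto
      then show ?thesis
        using card_UN_le[OF fin12(2), of "\<lambda>Z. {e \<in> X \<times> (Z \<inter> T). e \<notin># H}"] by simp
    qed
    ultimately show ?thesis by linarith
  qed
  moreover have "sum ?q L = sum ?q L1 + sum ?q L2"
    unfolding L1_def using \<open>finite L\<close> L12(2) by (simp add: sum.subset_diff)
  moreover have "sum m S = sum m X + sum m (S - \<Inter>L)"
  proof -
    have "S = X \<union> (S - \<Inter>L)" "X \<inter> (S - \<Inter>L) = {}" by (auto simp: X_def)
    then show ?thesis using fin sum.union_disjoint[of X "S - \<Inter>L" m]
      by (metis finite_Diff finite_Int X_def)
  qed
  ultimately show "sum ?q L \<le> int (sum m (S - \<Inter>L))"
    using main by linarith
qed

section \<open>Degrees in bigraphs, and sufficiency of the inequality\<close>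

lemma degree_left:
  assumes "is_bigraph S T G" "S \<inter> T = {}" "s \<in> S"
  shows "degree G s = size {#e \<in># G. fst e = s#}"
proof -
  have "{#e \<in># G. fst e = s \<or> snd e = s#} = {#e \<in># G. fst e = s#}"
    using assms by (intro filter_mset_cong) (auto simp: is_bigraph_def)
  then show ?thesis by (simp add: degree_def)
qed

lemma degree_right:
  assumes "is_bigraph S T G" "S \<inter> T = {}" "t \<in> T"
  shows "degree G t = size {#e \<in># G. snd e = t#}"
proof -
  have "{#e \<in># G. fst e = t \<or> snd e = t#} = {#e \<in># G. snd e = t#}"
    using assms by (intro filter_mset_cong) (auto simp: is_bigraph_def)
  then show ?thesis by (simp add: degree_def)
qed

lemma sum_size_filter_mset_eq:
  assumes "finite A" "\<forall>e\<in>#G. f e \<in> A"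
  shows "(\<Sum>x\<in>A. size {#e \<in># G. f e = x#}) = size G"
  using assms(2)
proof (induction G)
  case (add e G)
  have "(\<Sum>x\<in>A. size {#e' \<in># add_mset e G. f e' = x#}) =
      (\<Sum>x\<in>A. of_bool (f e = x) + size {#e' \<in># G. f e' = x#})"
    by (rule sum.cong) auto
  also have "\<dots> = Suc (\<Sum>x\<in>A. size {#e' \<in># G. f e' = x#})"
    using add.prems assms(1) by (simp add: sum.distrib)
  finally show ?case using add by simp
qed simp

text \<open>Three kinds of sets turn the demands back into properties of \<open>G\<close>:
  singletons \<open>{t}\<close> give the degrees on \<open>T\<close>, pairs \<open>{s, t}\<close>
  give simplicity, and a set \<open>A\<close> with all its neighbours gives the rank
  condition.\<close>

lemma fitting_cover_exists:
  fixes m :: "'v \<Rightarrow> nat"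
  assumes fin: "finite S" "finite T" and disj: "S \<inter> T = {}"
    and H: "is_bigraph S T H" "simple H" and mat: "matroid S r" and "p {} \<le> 0"
    and p: "positively_intersecting_supermodular T p"
    and sums: "sum m T = sum m S"
    and cond: "\<And>X Y P. X \<subseteq> S \<Longrightarrow> Y \<subseteq> T \<Longrightarrow> subpartition (T - Y) P \<Longrightarrow>
      int (sum m X) + int (sum m Y) - int (card {e \<in> X \<times> Y. e \<notin># H})
        + (\<Sum>A\<in>P. p A - int (r (X \<union> neighbours H A))) \<le> int (sum m S)"
  shows "\<exists>G. is_bigraph S T G \<and> fits S T G m \<and> simple (G + H) \<and> matroid_covers T r (G + H) p"
proof -
  let ?q = "demand S T H r p m"
  have q_single: "?q {t} = int (m t)" if "t \<in> T" for t
  proof -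
    have tT: "{t} \<inter> T = {t}" and tS: "{t} \<inter> S = {}" using that disj by auto
    \<comment> \<open>With \<open>X\<close> empty and \<open>Y = T - {t}\<close>, the hypothesis
      says that the rank demand of \<open>{t}\<close> is at most \<open>m t\<close>; the degree
      demand attains the maximum.\<close>
    have "int (sum m (T - {t})) + (p {t} - int (r (neighbours H {t}))) \<le> int (sum m S)"
      using cond[of "{}" "T - {t}" "{{t}}"] that by (simp add: subpartition_def)
    moreover have "sum m T = m t + sum m (T - {t})"
      using fin(2) that by (rule sum.remove)
    ultimately have "rank_demand S T H r p {t} \<le> int (m t)"
      unfolding rank_demand_def tT tS Un_empty_left using sums by linarith
    moreover have "degree_demand S T H m {t} = int (m t)"
      by (simp add: degree_demand_singleton[OF tT] tS)
    ultimately show ?thesis by (simp add: demand_def tT)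
  qed
  have "\<exists>G. is_bigraph S T G \<and> (\<forall>s\<in>S. size {#e \<in># G. fst e = s#} = m s) \<and>
      (\<forall>Z\<subseteq>S \<union> T. Z \<inter> T \<noteq> {} \<longrightarrow> ?q Z \<le> int (size {#e \<in># G. entering e Z#}))"
  proof (rule covering_bigraph_exists[OF fin disj])
    show "positively_supermodular_on S T ?q"
      by (rule demand_supermodular[OF fin(1) mat H(1) p])
    show "packing_bound S T ?q m"
      by (rule demand_packing_bound[OF fin mat H(1) cond])
  qed (use q_single sums in auto)
  then obtain G where G: "is_bigraph S T G" and out: "\<And>s. s \<in> S \<Longrightarrow> size {#e \<in># G. fst e = s#} = m s"
    and cover: "\<And>Z. Z \<subseteq> S \<union> T \<Longrightarrow> Z \<inter> T \<noteq> {} \<Longrightarrow> ?q Z \<le> int (size {#e \<in># G. entering e Z#})"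
    by blast
  have e_in: "fst e \<in> S" "snd e \<in> T" if "e \<in># G" for e
    using G that by (auto simp: is_bigraph_def)
  have H_le: "count H e \<le> 1" for e
    using H(2) unfolding simple_def by blast
  have fst_notin: "fst e \<notin> T" and snd_notin: "snd e \<notin> S" if "e \<in># G" for e
    using e_in[OF that] disj by blast+
  have ge: "m t \<le> size {#e \<in># G. snd e = t#}" if "t \<in> T" for t
  proof -
    have "{#e \<in># G. entering e {t}#} = {#e \<in># G. snd e = t#}"
      using fst_notin that by (intro filter_mset_cong) (fastforce simp: entering_def)+
    then show ?thesis using cover[of "{t}"] q_single that by auto
  qed
  have "(\<Sum>t\<in>T. size {#e \<in># G. snd e = t#}) = size G"
    using fin e_in by (intro sum_size_filter_mset_eq) auto
  also have "\<dots> = (\<Sum>s\<in>S. size {#e \<in># G. fst e = s#})"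
    using fin e_in by (intro sum_size_filter_mset_eq[symmetric]) auto
  also have "\<dots> = sum m T" using out sums by simp
  \<comment> \<open>The lower bounds \<open>ge\<close> have the same total as the actual degrees, so
    each is an equality.\<close>
  finally have into: "m t = size {#e \<in># G. snd e = t#}" if "t \<in> T" for t
    using sum_mono_inv[of m T "\<lambda>t. size {#e \<in># G. snd e = t#}" t] ge that fin by simp
  have "fits S T G m"
    unfolding fits_def
    using degree_left[OF G disj] degree_right[OF G disj] out into by auto
  moreover have "simple (G + H)"
    unfolding simple_def
  proof
    fix e
    show "count (G + H) e \<le> 1"
    proof (cases "e \<in># G")
      case False
      then show ?thesis using H_le[of e] by (simp add: not_in_iff)
    next
      case True
      obtain s t where e: "e = (s, t)" by force
      then have st: "s \<in> S" "t \<in> T" using e_in[OF True] by auto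
      \<comment> \<open>Of the \<open>m t\<close> edges at \<open>t\<close>, those entering
        \<open>?Z\<close> are the ones not from \<open>s\<close>. The degree demand thus leaves at
        most one copy of \<open>e\<close>, and none if \<open>e\<close> is in
        \<open>H\<close>.\<close>
      let ?Z = "{s, t}"
      have ZT: "?Z \<inter> T = {t}" and ZS: "?Z \<inter> S = {s}" using st disj by auto
      have "degree_demand S T H m ?Z \<le> ?q ?Z" by (simp add: demand_def ZT)
      also have "\<dots> \<le> int (size {#e \<in># G. entering e ?Z#})"
        using st by (intro cover) auto
      also have "{#e \<in># G. entering e ?Z#} = {#e \<in># G. snd e = t \<and> fst e \<noteq> s#}"
        using fst_notin snd_notin st by (intro filter_mset_cong) (fastforce simp: entering_def)+
      finally have "int (m t) - int (card {s' \<in> {s}. (s', t) \<notin># H}) \<le>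
          int (size {#e \<in># G. snd e = t \<and> fst e \<noteq> s#})"
        unfolding degree_demand_singleton[OF ZT] ZS .
      moreover have "{s' \<in> {s}. (s', t) \<notin># H} = (if e \<in># H then {} else {s})"
        by (auto simp: e)
      moreover have "m t = count G e + size {#e \<in># G. snd e = t \<and> fst e \<noteq> s#}"
      proof -
        have "{#e' \<in># G. snd e' = t#} = {#e' \<in># G. e' = e#} + {#e' \<in># G. snd e' = t \<and> fst e' \<noteq> s#}"
          by (rule multiset_eqI) (auto simp: e)
        then show ?thesis using into[OF st(2)] by (simp add: filter_eq_replicate_mset)
      qed
      ultimately have "count G e \<le> (if e \<in># H then 0 else 1)"
        by (auto split: if_splits)
      then show ?thesis using H_le[of e] by (auto simp: not_in_iff split: if_splits)
    qed
  qed
  moreover have "matroid_covers T r (G + H) p"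
    unfolding matroid_covers_def
  proof (intro allI impI)
    fix A assume A: "A \<subseteq> T"
    let ?N = "neighbours (G + H) A"
    show "p A \<le> int (r ?N)"
    proof (cases "A = {}")
      case True
      then show ?thesis using \<open>p {} \<le> 0\<close> by simp
    next
      case False
      \<comment> \<open>All ends of edges of \<open>G\<close> at \<open>A\<close> lie in
        \<open>?N\<close>, so no edge enters \<open>?Z\<close> and its rank demand is at most
        zero.\<close>
      let ?Z = "A \<union> ?N"
      have "is_bigraph S T (G + H)" using G H(1) by (auto simp: is_bigraph_def)
      then have N: "?N \<subseteq> S" by (rule neighbours_subset)
      then have ZT: "?Z \<inter> T = A" and ZS: "?Z \<inter> S = ?N" using A disj by blast+
      have "rank_demand S T H r p ?Z \<le> ?q ?Z" by (simp add: demand_def)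
      also have "\<dots> \<le> int (size {#e \<in># G. entering e ?Z#})"
        using A N False ZT by (intro cover) auto
      also have "{#e \<in># G. entering e ?Z#} = {#}"
      proof -
        have "\<not> entering e ?Z" if "e \<in># G" for e
        proof -
          obtain s t where e: "e = (s, t)" by force
          have "t \<notin> ?N" if "t \<in> T" using that N disj by blast
          then show ?thesis
            using e_in[OF \<open>e \<in># G\<close>] \<open>e \<in># G\<close> by (auto simp: entering_def neighbours_def e)
        qed
        then show ?thesis by auto
      qed
      finally have "p A \<le> int (r (?N \<union> neighbours H A))"
        unfolding rank_demand_def ZT ZS by simp
      moreover have "?N \<union> neighbours H A = ?N" by (auto simp: neighbours_def)
      ultimately show ?thesis by simp
    qed
  qed
  ultimately show ?thesis using G by blast
qed

section \<open>Necessity of the inequality\<close>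

text \<open>Double counting of the edges of \<open>G\<close>. Those meeting \<open>X\<close> or
  \<open>Y\<close> are disjoint from those that join \<open>S - X\<close> to members of
  \<open>P\<close>, and each \<open>A\<close> in \<open>P\<close> needs enough of the latter to make
  up its missing rank.\<close>

lemma fitting_cover_bound:
  fixes m :: "'v \<Rightarrow> nat"
  assumes fin: "finite S" "finite T" and disj: "S \<inter> T = {}"
    and H: "is_bigraph S T H" and mat: "matroid S r"
    and G: "is_bigraph S T G" "fits S T G m" "simple (G + H)" "matroid_covers T r (G + H) p"
    and X: "X \<subseteq> S" and Y: "Y \<subseteq> T" and P: "subpartition (T - Y) P"
  shows "int (sum m X) + int (sum m Y) - int (card {e \<in> X \<times> Y. e \<notin># H})
      + (\<Sum>A\<in>P. p A - int (r (X \<union> neighbours H A))) \<le> int (sum m S)"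
proof -
  define E where "E = set_mset G"
  have E: "E \<subseteq> S \<times> T" using G(1) by (simp add: E_def is_bigraph_def)
  have finE: "finite E" by (simp add: E_def)
  have one: "count G e + count H e \<le> 1" for e
    using G(3) unfolding simple_def by (metis count_union)
  \<comment> \<open>Simplicity of \<open>G + H\<close> allows \<open>G\<close> to be treated as a
    plain set of edges, disjoint from \<open>H\<close>.\<close>
  have GE: "G = mset_set E"
  proof (rule multiset_eqI)
    fix e
    show "count G e = count (mset_set E) e"
    proof (cases "e \<in># G")
      case True
      then have "count G e > 0" by simp
      then have "count G e = 1" using one[of e] by linarith
      then show ?thesis using True by (simp add: E_def)
    qed (simp add: E_def not_in_iff)
  qed
  have EH: "e \<notin># H" if "e \<in> E" for e
  proof -
    have "count G e > 0" using that by (simp add: E_def)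
    then have "count H e = 0" using one[of e] by linarith
    then show ?thesis by (simp add: not_in_iff)
  qed
  have degL: "m s = card {e \<in> E. fst e = s}" if "s \<in> S" for s
    using G(2) degree_left[OF G(1) disj that] that finE by (simp add: fits_def GE)
  have degR: "m t = card {e \<in> E. snd e = t}" if "t \<in> T" for t
    using G(2) degree_right[OF G(1) disj that] that finE by (simp add: fits_def GE)
  have sumL: "sum m B = card {e \<in> E. fst e \<in> B}" if "B \<subseteq> S" for B
  proof -
    have "{e \<in> E. fst e \<in> B} = (\<Union>s\<in>B. {e \<in> E. fst e = s})" by blast
    moreover have "card (\<Union>s\<in>B. {e \<in> E. fst e = s}) = (\<Sum>s\<in>B. card {e \<in> E. fst e = s})"
      using that fin finE by (intro card_UN_disjoint) (auto intro: finite_subset)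
    ultimately show ?thesis using degL that by (auto intro!: sum.cong)
  qed
  have sumR: "sum m B = card {e \<in> E. snd e \<in> B}" if "B \<subseteq> T" for B
  proof -
    have "{e \<in> E. snd e \<in> B} = (\<Union>t\<in>B. {e \<in> E. snd e = t})" by blast
    moreover have "card (\<Union>t\<in>B. {e \<in> E. snd e = t}) = (\<Sum>t\<in>B. card {e \<in> E. snd e = t})"
      using that fin finE by (intro card_UN_disjoint) (auto intro: finite_subset)
    ultimately show ?thesis using degR that by (auto intro!: sum.cong)
  qed
  let ?EX = "{e \<in> E. fst e \<in> X}" and ?EY = "{e \<in> E. snd e \<in> Y}"
  let ?EA = "\<lambda>A. {e \<in> E. fst e \<notin> X \<and> snd e \<in> A}"
  have PT: "A \<subseteq> T - Y" if "A \<in> P" for A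
    using P that unfolding subpartition_def by blast
  have finP: "finite P"
    using PT fin by (intro finite_subset[of P "Pow T"]) auto
  have "card ?EX + card ?EY = card (?EX \<union> ?EY) + card (?EX \<inter> ?EY)"
    using finE by (intro card_Un_Int) auto
  moreover have "card (?EX \<inter> ?EY) \<le> card {e \<in> X \<times> Y. e \<notin># H}"
  proof (rule card_mono)
    show "finite {e \<in> X \<times> Y. e \<notin># H}"
      using X Y fin by (auto intro: finite_subset)
    show "?EX \<inter> ?EY \<subseteq> {e \<in> X \<times> Y. e \<notin># H}"
      using EH by auto
  qed
  moreover have "(\<Sum>A\<in>P. p A - int (r (X \<union> neighbours H A))) \<le> (\<Sum>A\<in>P. int (card (?EA A)))"
  proof (rule sum_mono)
    fix A assume A: "A \<in> P"
    have "p A \<le> int (r (neighbours (G + H) A))"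
      using G(4) PT[OF A] unfolding matroid_covers_def by blast
    \<comment> \<open>A neighbour of \<open>A\<close> outside \<open>X\<close> and outside the
      neighbours in \<open>H\<close> is the end of an edge in \<open>?EA A\<close>; each such end
      raises the rank by at most one.\<close>
    moreover have "r (neighbours (G + H) A) \<le> r ((X \<union> neighbours H A) \<union> fst ` ?EA A)"
    proof (rule rank_mono[OF mat])
      show "neighbours (G + H) A \<subseteq> (X \<union> neighbours H A) \<union> fst ` ?EA A"
        by (force simp: neighbours_def E_def)
      show "(X \<union> neighbours H A) \<union> fst ` ?EA A \<subseteq> S"
        using X neighbours_subset[OF H] E by auto
    qed
    moreover have "\<dots> \<le> r (X \<union> neighbours H A) + card (fst ` ?EA A)"
      using X neighbours_subset[OF H] E by (intro rank_Un_le[OF mat]) auto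
    moreover have "card (fst ` ?EA A) \<le> card (?EA A)"
      using finE by (intro card_image_le) auto
    ultimately show "p A - int (r (X \<union> neighbours H A)) \<le> int (card (?EA A))"
      by linarith
  qed
  moreover have "(\<Sum>A\<in>P. card (?EA A)) = card (\<Union>A\<in>P. ?EA A)"
  proof (rule card_UN_disjoint[symmetric])
    show "\<forall>A\<in>P. \<forall>B\<in>P. A \<noteq> B \<longrightarrow> ?EA A \<inter> ?EA B = {}"
      using P unfolding subpartition_def disjoint_def by blast
  qed (use finP finE in auto)
  moreover have "card (?EX \<union> ?EY) + card (\<Union>A\<in>P. ?EA A) \<le> card E"
  proof -
    have "(?EX \<union> ?EY) \<inter> (\<Union>A\<in>P. ?EA A) = {}" using PT by blast
    moreover have "finite (?EX \<union> ?EY)" "finite (\<Union>A\<in>P. ?EA A)" using finP finE by auto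
    ultimately have "card (?EX \<union> ?EY) + card (\<Union>A\<in>P. ?EA A) = card ((?EX \<union> ?EY) \<union> (\<Union>A\<in>P. ?EA A))"
      by (simp add: card_Un_disjoint)
    also have "\<dots> \<le> card E" using finE by (intro card_mono) auto
    finally show ?thesis .
  qed
  moreover have "sum m S = card E"
  proof -
    have "{e \<in> E. fst e \<in> S} = E" using E by auto
    then show ?thesis using sumL[of S] by simp
  qed
  ultimately show ?thesis
    unfolding sumL[OF X] sumR[OF Y] by (simp flip: of_nat_sum)
qed

theorem theorem2:
  fixes S T :: "'v set"
    and H\<^sub>0 G\<^sub>0 :: "'v bigraph"
    and r :: "'v set \<Rightarrow> nat"
    and p :: "'v set \<Rightarrow> int"
    and m :: "'v \<Rightarrow> nat"
    and \<gamma> :: nat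
  assumes "finite S" and "finite T" and "S \<noteq> {}" and "T \<noteq> {}" and "S \<inter> T = {}"
    and "is_bigraph S T H\<^sub>0" and "simple H\<^sub>0"
    and "G\<^sub>0 = bip_complement S T H\<^sub>0"
    and "matroid S r"
    and "p {} \<le> 0"
    and "positively_intersecting_supermodular T p"
    and "(\<Sum>v\<in>S. m v) = \<gamma>" and "(\<Sum>v\<in>T. m v) = \<gamma>"
  shows "(\<exists>G. is_bigraph S T G \<and> fits S T G m \<and>
            simple (G + H\<^sub>0) \<and> matroid_covers T r (G + H\<^sub>0) p) \<longleftrightarrow>
         (\<forall>X Y P. X \<subseteq> S \<and> Y \<subseteq> T \<and> subpartition (T - Y) P \<longrightarrow>
            int (\<Sum>v\<in>X. m v) + int (\<Sum>v\<in>Y. m v) - int (edges_between G\<^sub>0 X Y)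
              + (\<Sum>A\<in>P. p A - int (r (X \<union> neighbours H\<^sub>0 A))) \<le> int \<gamma>)"
proof -
  have edges: "edges_between G\<^sub>0 X Y = card {e \<in> X \<times> Y. e \<notin># H\<^sub>0}" if "X \<subseteq> S" "Y \<subseteq> T" for X Y
    using edges_between_bip_complement[OF \<open>finite S\<close> \<open>finite T\<close> that] assms(8) by simp
  show ?thesis
  proof (intro iffI allI impI)
    fix X Y P
    assume ex: "\<exists>G. is_bigraph S T G \<and> fits S T G m \<and>
      simple (G + H\<^sub>0) \<and> matroid_covers T r (G + H\<^sub>0) p"
      and "X \<subseteq> S \<and> Y \<subseteq> T \<and> subpartition (T - Y) P"
    then have XYP: "X \<subseteq> S" "Y \<subseteq> T" "subpartition (T - Y) P"
      by simp_all
    obtain G where G: "is_bigraph S T G" "fits S T G m" "simple (G + H\<^sub>0)"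
        "matroid_covers T r (G + H\<^sub>0) p"
      using ex by (elim exE conjE)
    show "int (\<Sum>v\<in>X. m v) + int (\<Sum>v\<in>Y. m v) - int (edges_between G\<^sub>0 X Y)
        + (\<Sum>A\<in>P. p A - int (r (X \<union> neighbours H\<^sub>0 A))) \<le> int \<gamma>"
      using fitting_cover_bound[OF assms(1,2,5,6,9) G XYP] edges[OF XYP(1,2)] assms(12) by simp
  next
    assume cond: "\<forall>X Y P. X \<subseteq> S \<and> Y \<subseteq> T \<and> subpartition (T - Y) P \<longrightarrow>
      int (\<Sum>v\<in>X. m v) + int (\<Sum>v\<in>Y. m v) - int (edges_between G\<^sub>0 X Y)
        + (\<Sum>A\<in>P. p A - int (r (X \<union> neighbours H\<^sub>0 A))) \<le> int \<gamma>"
    show "\<exists>G. is_bigraph S T G \<and> fits S T G m \<and>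
        simple (G + H\<^sub>0) \<and> matroid_covers T r (G + H\<^sub>0) p"
    proof (rule fitting_cover_exists[OF assms(1,2,5,6,7,9,10,11)])
      show "sum m T = sum m S" using assms(12,13) by simp
      fix X Y P assume "X \<subseteq> S" "Y \<subseteq> T" "subpartition (T - Y) P"
      then show "int (sum m X) + int (sum m Y) - int (card {e \<in> X \<times> Y. e \<notin># H\<^sub>0})
          + (\<Sum>A\<in>P. p A - int (r (X \<union> neighbours H\<^sub>0 A))) \<le> int (sum m S)"
        using cond[rule_format, of X Y P] edges[of X Y] assms(12) by simp
    qed
  qed
qed

end
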